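(* Let $A_1,\dots,A_M\in\mathbb{R}^{n\times n}$, $\mathcal{M}=\{1,\dots,M\}$ and $A(w)=\sum_{i\in\mathcal{M}}w_iA_i$ for $w\in\mathcal{W}$. Let $V$ be a positively homogeneous weak convex Lyapunov function for the difference inclusion $x(k+1)=A(w(k))x(k)$. Then every solution $x(k)$ of the difference inclusion converges to the set $$\mathcal{D}=\Big\{x\in\mathbb{R}^n\ \Big|\ \min_{w\in\mathcal{W}}\{V(x)-V(A(w)x)\}=0\Big\}.$$
   Context: $\mathcal{W}=\{w\in\mathbb{R}^M:\ \sum_{i\in\mathcal{M}}w_i=1,\ w_i\ge0\ \forall i\in\mathcal{M}\}$; solutions are those generated by arbitrary sequences $w(k)\in\mathcal{W}$, $k\in\mathbb{N}$, and arbitrary $x(0)\in\mathbb{R}^n$. A weak convex Lyapunov function for the difference inclusion is a convex positive definite function $V:\mathbb{R}^n\to\mathbb{R}_{\ge0}$ with $V(A(w)x)\le V(x)$ for all $x\in\mathbb{R}^n$, $w\in\mathcal{W}$. Positively homogeneous means $V(\lambda x)=\lambda^pV(x)$ for all $\lambda\ge0$, $x\in\mathbb{R}^n$, for some order $p>0$. Convergence to a set means that the distance from $x(k)$ to the set tends to $0$ as $k\to\infty$. *)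

theory Defs
  imports "HOL-Analysis.Analysis"
begin

definition weights :: "(real ^ 'm) set" where
  "weights = {w. (\<Sum>i\<in>UNIV. w $ i) = 1 \<and> (\<forall>i. w $ i \<ge> 0)}"

definition comb_matrix :: "('m::finite \<Rightarrow> real ^ 'n ^ 'n) \<Rightarrow> real ^ 'm \<Rightarrow> real ^ 'n ^ 'n" where
  "comb_matrix A w = (\<Sum>i\<in>UNIV. w $ i *\<^sub>R A i)"

definition is_solution ::
  "('m::finite \<Rightarrow> real ^ 'n ^ 'n) \<Rightarrow> (nat \<Rightarrow> real ^ 'n) \<Rightarrow> bool" where
  "is_solution A x \<longleftrightarrow>
     (\<exists>w. (\<forall>k. w k \<in> weights) \<and> (\<forall>k. x (Suc k) = comb_matrix A (w k) *v x k))"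

definition positive_definite :: "('a::real_vector \<Rightarrow> real) \<Rightarrow> bool" where
  "positive_definite V \<longleftrightarrow> V 0 = 0 \<and> (\<forall>x. x \<noteq> 0 \<longrightarrow> V x > 0)"

(* The order p is a positive real; 0 powr p = 0 makes the case c = 0 the intended one. *)
definition positively_homogeneous :: "('a::real_vector \<Rightarrow> real) \<Rightarrow> bool" where
  "positively_homogeneous V \<longleftrightarrow>
     (\<exists>p>0. \<forall>c\<ge>0. \<forall>x. V (c *\<^sub>R x) = c powr p * V x)"

definition weak_convex_lyapunov ::
  "('m::finite \<Rightarrow> real ^ 'n ^ 'n) \<Rightarrow> (real ^ 'n \<Rightarrow> real) \<Rightarrow> bool" where
  "weak_convex_lyapunov A V \<longleftrightarrow>
     convex_on UNIV V \<and> positive_definite V \<and>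
     (\<forall>x. \<forall>w\<in>weights. V (comb_matrix A w *v x) \<le> V x)"

(* Attained minimum of a possibly infinite set, where Min does not apply. *)
definition is_minimum :: "real \<Rightarrow> real set \<Rightarrow> bool" where
  "is_minimum m S \<longleftrightarrow> m \<in> S \<and> (\<forall>s\<in>S. m \<le> s)"

definition zero_decrease_set ::
  "('m::finite \<Rightarrow> real ^ 'n ^ 'n) \<Rightarrow> (real ^ 'n \<Rightarrow> real) \<Rightarrow> (real ^ 'n) set" where
  "zero_decrease_set A V =
     {x. is_minimum 0 ((\<lambda>w. V x - V (comb_matrix A w *v x)) ` weights)}"

(* Nonemptiness is required because infdist x {} = 0. *)
definition converges_to_set :: "(nat \<Rightarrow> 'a::metric_space) \<Rightarrow> 'a set \<Rightarrow> bool" where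
  "converges_to_set x S \<longleftrightarrow> S \<noteq> {} \<and> (\<lambda>k. infdist (x k) S) \<longlonglongrightarrow> 0"

end

theory Submission
  imports Defs
begin

text \<open>
  The argument is a LaSalle invariance argument. A convex function on a Euclidean space is
  continuous, and a positive definite one grows at least linearly, so the sublevel sets of \<open>V\<close>
  are bounded and every solution stays in a bounded set (\<open>bounded_sublevel_convex_posdef\<close>).
  Along a solution the values \<open>V (x k)\<close> decrease and are nonnegative, hence they tend
  to some \<open>L\<close>. Take a limit \<open>y\<close> of a subsequence of \<open>x\<close>. As the weights form a compact
  set, a further subsequence of them tends to some weight \<open>w\<close>, and then the
  successors tend to \<open>A(w) y\<close>. Continuity gives \<open>V y = L = V (A(w) y)\<close>, so the minimal decrease
  at \<open>y\<close> is zero (\<open>subsequence_limit_in_zero_decrease_set\<close>). A bounded sequence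
  converges to any set that contains all its subsequential limits
  (\<open>bounded_infdist_tendsto_0\<close>), and the set of zero decrease is nonempty because it contains \<open>0\<close>.
\<close>

text \<open>
  Terms at distance at least \<open>e\<close> from \<open>S\<close> along a subsequence would, by boundedness, have a
  cluster point at distance at least \<open>e\<close> from \<open>S\<close>, although all cluster points lie in \<open>S\<close>.
\<close>
lemma bounded_infdist_tendsto_0:
  fixes x :: "nat \<Rightarrow> 'a::heine_borel"
  assumes bd: "bounded (range x)"
    and lim: "\<And>r l. strict_mono r \<Longrightarrow> (x \<circ> r) \<longlonglongrightarrow> l \<Longrightarrow> l \<in> S"
  shows "(\<lambda>k. infdist (x k) S) \<longlonglongrightarrow> 0"
proof (rule ccontr)
  assume "\<not> ?thesis"
  then obtain e where "e > 0" and "\<not> (\<forall>\<^sub>F k in sequentially. infdist (x k) S < e)"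
    by (auto simp: tendsto_iff infdist_nonneg)
  then obtain s :: "nat \<Rightarrow> nat" where s: "strict_mono s"
    and far: "\<And>k. \<not> infdist (x (s k)) S < e"
    using not_eventually_sequentiallyD by blast
  have "bounded (range (x \<circ> s))"
    using bd by (rule bounded_subset) auto
  then obtain l r where r: "strict_mono r" and l: "(x \<circ> s \<circ> r) \<longlonglongrightarrow> l"
    using bounded_imp_convergent_subsequence by blast
  have "l \<in> S"
    using lim[OF strict_mono_o[OF s r]] l by (simp add: o_assoc)
  have "(\<lambda>k. infdist (x (s (r k))) S) \<longlonglongrightarrow> infdist l S"
    using tendsto_infdist[OF l] by (simp add: o_def)
  then have "(\<lambda>k. infdist (x (s (r k))) S) \<longlonglongrightarrow> 0"
    using \<open>l \<in> S\<close> by simp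
  then have "\<forall>\<^sub>F k in sequentially. infdist (x (s (r k))) S < e"
    using \<open>e > 0\<close> by (rule order_tendstoD(2))
  then show False
    using far by (simp add: eventually_sequentially)
qed

text \<open>
  Convexity along the segment from \<open>0\<close> to \<open>y\<close>, together with \<open>V 0 = 0\<close>, gives
  \<open>V y \<ge> norm y * V (y / norm y)\<close> once \<open>norm y \<ge> 1\<close>. On the compact unit sphere \<open>V\<close> has a
  positive minimum, so \<open>V\<close> grows at least linearly.
\<close>
lemma bounded_sublevel_convex_posdef:
  fixes V :: "'a::euclidean_space \<Rightarrow> real"
  assumes conv: "convex_on UNIV V" and pd: "positive_definite V"
  shows "bounded {y. V y \<le> c}"
proof -
  have cont: "continuous_on UNIV V"
    using conv by (simp add: convex_on_continuous)
  obtain u :: 'a where "norm u = 1"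
    using vector_choose_size[of 1] by auto
  then obtain z where z: "norm z = 1" and zmin: "\<And>y. norm y = 1 \<Longrightarrow> V z \<le> V y"
    using continuous_attains_inf[of "sphere 0 1" V] continuous_on_subset[OF cont]
    by (auto simp: dist_norm)
  have pos: "V z > 0"
    using pd z by (cases "z = 0") (auto simp: positive_definite_def)
  have growth: "norm y * V z \<le> V y" if "norm y \<ge> 1" for y
  proof -
    have "inverse (norm y) \<le> 1"
      using that by (simp add: inverse_le_1_iff)
    then have "V (y /\<^sub>R norm y) \<le> V y / norm y"
      using convex_onD[OF conv, of "inverse (norm y)" 0 y] pd
      by (simp add: positive_definite_def divide_inverse mult.commute)
    moreover have "V z \<le> V (y /\<^sub>R norm y)"
      using that by (intro zmin) (auto intro: left_inverse)
    ultimately have "V z \<le> V y / norm y"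
      by linarith
    moreover have "norm y > 0"
      using that by linarith
    ultimately show ?thesis
      by (simp add: pos_le_divide_eq mult.commute)
  qed
  have "norm y \<le> max 1 (c / V z)" if "V y \<le> c" for y
  proof (cases "norm y \<ge> 1")
    case True
    then have "norm y * V z \<le> c"
      using growth[of y] that by linarith
    then show ?thesis
      using pos by (simp add: pos_le_divide_eq le_max_iff_disj)
  qed auto
  then show ?thesis
    unfolding bounded_iff by blast
qed

lemma compact_weights: "compact (weights :: (real ^ 'm::finite) set)"
proof -
  have "norm w \<le> 1" if "w \<in> weights" for w :: "real ^ 'm"
    using norm_le_l1_cart[of w] that by (simp add: weights_def)
  then have "bounded (weights :: (real ^ 'm) set)"
    unfolding bounded_iff by blast
  moreover have "closed (weights :: (real ^ 'm) set)"
    unfolding weights_def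
    by (intro closed_Collect_conj closed_Collect_all closed_Collect_eq closed_Collect_le
        continuous_intros)
  ultimately show ?thesis
    by (simp add: compact_eq_bounded_closed)
qed

lemma axis_in_weights: "axis i 1 \<in> (weights :: (real ^ 'm::finite) set)"
  by (auto simp: weights_def axis_def)

lemma comb_matrix_vector:
  "comb_matrix A w *v y = (\<Sum>i\<in>UNIV. w $ i *\<^sub>R (A i *v y))"
proof -
  have "(\<Sum>i\<in>I. w $ i *\<^sub>R A i) *v y = (\<Sum>i\<in>I. w $ i *\<^sub>R (A i *v y))" if "finite I" for I
    using that by induction
      (auto simp: matrix_vector_mult_add_rdistrib scaleR_matrix_vector_assoc)
  then show ?thesis
    by (simp add: comb_matrix_def)
qed

lemma tendsto_comb_matrix_vector:
  assumes "(w \<longlongrightarrow> w') F" and "(y \<longlongrightarrow> y') F"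
  shows "((\<lambda>k. comb_matrix A (w k) *v y k) \<longlongrightarrow> comb_matrix A w' *v y') F"
  unfolding comb_matrix_vector
  by (intro tendsto_sum tendsto_scaleR tendsto_vec_nth assms
      bounded_linear.tendsto[OF matrix_vector_mul_bounded_linear])

lemma zero_decrease_setI:
  assumes "weak_convex_lyapunov A V" and "w \<in> weights" and "V (comb_matrix A w *v y) = V y"
  shows "y \<in> zero_decrease_set A V"
  using assms
  by (force simp: zero_decrease_set_def is_minimum_def weak_convex_lyapunov_def)

text \<open>
  The weights used at the times \<open>r k\<close> need not converge, but they do along a further
  subsequence \<open>q\<close>; then the successors \<open>x (Suc (q k))\<close> converge as well. Both \<open>V (x (q k))\<close> and
  \<open>V (x (Suc (q k)))\<close> are subsequences of the convergent sequence \<open>V (x k)\<close>, so their limits agree.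
\<close>
lemma subsequence_limit_in_zero_decrease_set:
  fixes A :: "'m::finite \<Rightarrow> real ^ 'n ^ 'n"
  assumes lyap: "weak_convex_lyapunov A V" and sol: "is_solution A x"
    and r: "strict_mono r" and lim: "(x \<circ> r) \<longlonglongrightarrow> y"
  shows "y \<in> zero_decrease_set A V"
proof -
  obtain w where w: "\<And>k. w k \<in> weights" and step: "\<And>k. x (Suc k) = comb_matrix A (w k) *v x k"
    using sol by (auto simp: is_solution_def)
  have V_nonneg: "V z \<ge> 0" for z
    using lyap
    by (cases "z = 0") (auto simp: weak_convex_lyapunov_def positive_definite_def less_imp_le)
  have "continuous_on UNIV V"
    using lyap by (simp add: weak_convex_lyapunov_def convex_on_continuous)
  then have V_lim: "(\<lambda>k. V (f k)) \<longlonglongrightarrow> V l" if "f \<longlonglongrightarrow> l" for f l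
    using continuous_on_tendsto_compose[of UNIV V] that by simp
  have "decseq (\<lambda>k. V (x k))"
    using lyap w by (intro decseq_SucI) (simp add: step weak_convex_lyapunov_def)
  then obtain L where L: "(\<lambda>k. V (x k)) \<longlonglongrightarrow> L"
    using decseq_convergent V_nonneg by metis
  obtain v s where v: "v \<in> weights" and s: "strict_mono s" and ws: "(w \<circ> r \<circ> s) \<longlonglongrightarrow> v"
    using compact_weights w unfolding compact_def by (metis comp_apply)
  define q where "q = r \<circ> s"
  have q: "strict_mono q"
    unfolding q_def using r s by (rule strict_mono_o)
  have xq: "(\<lambda>k. x (q k)) \<longlonglongrightarrow> y"
    using LIMSEQ_subseq_LIMSEQ[OF lim s] by (simp add: q_def o_def)
  have "(\<lambda>k. x (Suc (q k))) \<longlonglongrightarrow> comb_matrix A v *v y"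
    unfolding step using ws xq
    by (intro tendsto_comb_matrix_vector) (simp_all add: q_def o_def)
  then have "(\<lambda>k. V (x (Suc (q k)))) \<longlonglongrightarrow> V (comb_matrix A v *v y)"
    by (rule V_lim)
  moreover have "(\<lambda>k. V (x (Suc (q k)))) \<longlonglongrightarrow> L"
    using LIMSEQ_subseq_LIMSEQ[OF LIMSEQ_Suc[OF L] q] by (simp add: o_def)
  moreover have "V y = L"
    using LIMSEQ_unique[OF V_lim[OF xq]] LIMSEQ_subseq_LIMSEQ[OF L q] by (simp add: o_def)
  ultimately have "V (comb_matrix A v *v y) = V y"
    using LIMSEQ_unique by blast
  with lyap v show ?thesis
    by (rule zero_decrease_setI)
qed

lemma bounded_solution:
  fixes A :: "'m::finite \<Rightarrow> real ^ 'n ^ 'n"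
  assumes lyap: "weak_convex_lyapunov A V" and sol: "is_solution A x"
  shows "bounded (range x)"
proof -
  have "V (x (Suc k)) \<le> V (x k)" for k
    using lyap sol by (auto simp: weak_convex_lyapunov_def is_solution_def)
  then have "V (x k) \<le> V (x 0)" for k
    by (induction k) (auto intro: order_trans)
  then have "range x \<subseteq> {y. V y \<le> V (x 0)}"
    by auto
  then show ?thesis
    using lyap bounded_sublevel_convex_posdef[of V] bounded_subset
    unfolding weak_convex_lyapunov_def by blast
qed

theorem proposition8:
  fixes A :: "'m::finite \<Rightarrow> real ^ 'n ^ 'n"
    and V :: "real ^ 'n \<Rightarrow> real"
    and x :: "nat \<Rightarrow> real ^ 'n"
  assumes "weak_convex_lyapunov A V"
    and "positively_homogeneous V"
    and "is_solution A x"
  shows "converges_to_set x (zero_decrease_set A V)"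
proof -
  have "0 \<in> zero_decrease_set A V"
    using assms(1) axis_in_weights by (rule zero_decrease_setI) simp
  moreover have "(\<lambda>k. infdist (x k) (zero_decrease_set A V)) \<longlonglongrightarrow> 0"
    using bounded_solution[OF assms(1,3)]
      subsequence_limit_in_zero_decrease_set[OF assms(1,3)]
    by (rule bounded_infdist_tendsto_0)
  ultimately show ?thesis
    by (auto simp: converges_to_set_def)
qed

end
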